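(* Let $\alpha\in\mathbb{D}$ and let $\phi_\alpha(z)=\frac{z-\alpha}{1-\overline{\alpha}z}$ for $z\in\mathbb{D}$. Then the Berezin range of the composition operator $C_{\phi_\alpha}$ on the Bergman space $A^2(\mathbb{D})$ is convex if and only if $\alpha=0$.
   Context: $\mathbb{D}$ is the open unit disc in $\mathbb{C}$. $A^2(\mathbb{D})$ is the Hilbert space of holomorphic functions $f$ on $\mathbb{D}$ with $\int_{\mathbb{D}}|f|^2\,dV<\infty$, where $dV$ is normalized area measure, with the $L^2(dV)$ inner product; its reproducing kernel at $w\in\mathbb{D}$ is $k_w(z)=\frac{1}{(1-\overline{w}z)^2}$. The normalized reproducing kernel is $\hat{k}_w=k_w/\|k_w\|$. The composition operator is $C_\phi f=f\circ\phi$. The Berezin range of a bounded operator $T$ on $A^2(\mathbb{D})$ is $\mathrm{Ber}(T)=\{\langle T\hat{k}_w,\hat{k}_w\rangle : w\in\mathbb{D}\}\subseteq\mathbb{C}$. *)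

theory Defs
  imports "HOL-Analysis.Analysis"
begin

abbreviation unit_disc :: "complex set" where
  "unit_disc \<equiv> ball 0 1"

text \<open>Normalized area measure: Lebesgue measure on the disc, scaled to total mass 1.\<close>

definition disc_measure :: "complex measure" where
  "disc_measure = uniform_measure (restrict_space lborel unit_disc) unit_disc"

text \<open>
  Functions on the disc are represented by functions of type \<^typ>\<open>complex \<Rightarrow> complex\<close>. Their values
  off the disc are irrelevant: \<open>disc_measure\<close> has the disc as its underlying space, and
  everything below depends only on the values in the disc.
\<close>

definition bergman_space :: "(complex \<Rightarrow> complex) set" where
  "bergman_space =
     {f. f holomorphic_on unit_disc \<and> integrable disc_measure (\<lambda>z. (cmod (f z))\<^sup>2)}"

definition bergman_inner :: "(complex \<Rightarrow> complex) \<Rightarrow> (complex \<Rightarrow> complex) \<Rightarrow> complex" where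
  "bergman_inner f g = (LINT z|disc_measure. f z * cnj (g z))"

definition bergman_norm :: "(complex \<Rightarrow> complex) \<Rightarrow> real" where
  "bergman_norm f = sqrt (LINT z|disc_measure. (cmod (f z))\<^sup>2)"

definition bergman_kernel :: "complex \<Rightarrow> complex \<Rightarrow> complex" where
  "bergman_kernel w z = 1 / (1 - cnj w * z)\<^sup>2"

definition normalized_bergman_kernel :: "complex \<Rightarrow> complex \<Rightarrow> complex" where
  "normalized_bergman_kernel w z = bergman_kernel w z / complex_of_real (bergman_norm (bergman_kernel w))"

definition berezin_range :: "((complex \<Rightarrow> complex) \<Rightarrow> (complex \<Rightarrow> complex)) \<Rightarrow> complex set" where
  "berezin_range T =
     {bergman_inner (T (normalized_bergman_kernel w)) (normalized_bergman_kernel w) | w. w \<in> unit_disc}"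

text \<open>An operator on the Bergman space is left unspecified outside \<open>bergman_space\<close>.\<close>

definition composition_operator :: "(complex \<Rightarrow> complex) \<Rightarrow> (complex \<Rightarrow> complex) \<Rightarrow> (complex \<Rightarrow> complex)" where
  "composition_operator \<phi> = (\<lambda>f\<in>bergman_space. f \<circ> \<phi>)"

definition disc_automorphism :: "complex \<Rightarrow> complex \<Rightarrow> complex" where
  "disc_automorphism \<alpha> z = (z - \<alpha>) / (1 - cnj \<alpha> * z)"

end

theory Submission
  imports Defs "HOL-Complex_Analysis.Complex_Analysis"
begin

text \<open>
  By the reproducing property, the Berezin transform of \<open>C\<^bsub>\<phi>\<^esub>\<close> at \<open>w\<close> is
  \<open>((1 - |w|\<^sup>2) (1 - u) / (1 - |w|\<^sup>2 - u + cnj u))\<^sup>2\<close> with \<open>u = cnj \<alpha> * w\<close>. For \<open>\<alpha> \<noteq> 0\<close> the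
  range is symmetric under conjugation, so convexity would put the real part of each of its points
  into it. But a point of the range is real only if \<open>u\<close> is real, and then it equals
  \<open>(1 - u)\<^sup>2 \<ge> (1 - |\<alpha>|)\<^sup>2\<close>, whereas \<open>0\<close> is a limit of points of the range.

  The reproducing property is obtained by averaging over rotations: by Cauchy's formula for the
  derivative, the mean of \<open>f * cnj (k w)\<close> over the circle of radius \<open>r\<close> is the derivative of
  \<open>t f(t w)\<close> at \<open>t = r\<^sup>2\<close>, and \<open>|z|\<^sup>2\<close> is uniformly distributed on \<open>[0,1]\<close>.
\<close>

section \<open>Lebesgue measure under orthogonal maps\<close>

text \<open>
  The uniqueness argument for Haar measure: the volume of \<open>T -` A\<close> times that of the unit ball
  is transformed by Fubini and translation invariance; \<open>T\<close> enters only through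
  the preimages of unit balls, which are unit balls.
\<close>

lemma lborel_distr_orthogonal_transformation:
  fixes T :: "'a::euclidean_space \<Rightarrow> 'a"
  assumes T: "orthogonal_transformation T"
  shows "distr lborel borel T = lborel"
proof (rule measure_eqI)
  have lin: "linear T" and nrm: "\<And>x. norm (T x) = norm x"
    using T by (auto simp: orthogonal_transformation)
  have T_meas [measurable]: "T \<in> borel_measurable borel"
    by (intro borel_measurable_continuous_onI linear_continuous_on linear_conv_bounded_linear[THEN iffD1] lin)
  show "sets (distr lborel borel T) = sets lborel" by simp
  fix A assume "A \<in> sets (distr lborel borel T)"
  then have [measurable]: "A \<in> sets borel" by simp
  have [measurable]: "Measurable.pred borel (\<lambda>y::'a. y \<in> ball 0 1)"
    by (simp add: pred_def)
  define c where "c = emeasure lborel (ball (0::'a) 1)"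
  have c: "c \<noteq> 0" "c \<noteq> \<infinity>"
    using emeasure_lborel_ball_finite[of "0::'a" 1] by (auto simp: c_def emeasure_ball less_imp_neq[OF unit_ball_vol_pos, symmetric])
  have shift: "(\<integral>\<^sup>+x. f (x + s) \<partial>lborel) = (\<integral>\<^sup>+x. f x \<partial>lborel)"
    if [measurable]: "f \<in> borel_measurable borel" for f :: "'a \<Rightarrow> ennreal" and s
  proof -
    have "(\<integral>\<^sup>+x. f x \<partial>lborel) = (\<integral>\<^sup>+x. f x \<partial>(distr lborel borel ((+) s)))"
      by (simp add: lborel_distr_plus)
    also have "\<dots> = (\<integral>\<^sup>+x. f (x + s) \<partial>lborel)"
      by (subst nn_integral_distr) (auto simp: add.commute)
    finally show ?thesis by simp
  qed
  have B: "(\<integral>\<^sup>+x. indicator (ball 0 1) (y - T x) \<partial>lborel) = c" for y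
  proof -
    obtain s where s: "y = T s"
      using orthogonal_transformation_surj[OF T] by (metis surjD)
    have "indicator (ball 0 1) (y - T x) = (indicator (ball s 1) x :: ennreal)" for x
    proof -
      have "norm (T x - y) = norm (s - x)"
        using nrm[of "x - s"] by (simp add: s linear_diff[OF lin] norm_minus_commute)
      then show ?thesis by (simp add: indicator_def dist_norm)
    qed
    then show ?thesis by (simp add: c_def emeasure_ball)
  qed
  have "emeasure (distr lborel borel T) A = (\<integral>\<^sup>+x. indicator A x \<partial>distr lborel borel T)"
    by simp
  also have "\<dots> = (\<integral>\<^sup>+x. indicator A (T x) \<partial>lborel)"
    by (rule nn_integral_distr) auto
  finally have "emeasure (distr lborel borel T) A * c
      = (\<integral>\<^sup>+y. \<integral>\<^sup>+x. indicator A (T x) * indicator (ball (0::'a) 1) y \<partial>lborel \<partial>lborel)"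
    by (subst nn_integral_multc, simp, subst nn_integral_cmult_indicator) (auto simp: c_def)
  \<comment> \<open>For fixed \<open>y = T s\<close>, shifting \<open>x\<close> by \<open>s\<close>
    turns \<open>T x\<close> into \<open>T x + y\<close>. After Fubini, shifting \<open>y\<close> by
    \<open>T x\<close> moves \<open>T\<close> out of the indicator of \<open>A\<close> and into that
    of the ball.\<close>
  also have "\<dots> = (\<integral>\<^sup>+y. \<integral>\<^sup>+x. indicator A (T x + y) * indicator (ball 0 1) y \<partial>lborel \<partial>lborel)"
  proof (rule nn_integral_cong)
    fix y :: 'a
    obtain s where s: "y = T s"
      using orthogonal_transformation_surj[OF T] by (metis surjD)
    show "(\<integral>\<^sup>+x. indicator A (T x) * indicator (ball 0 1) y \<partial>lborel)
        = (\<integral>\<^sup>+x. indicator A (T x + y) * indicator (ball 0 1) y \<partial>lborel)"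
      using shift[of "\<lambda>x. indicator A (T x) * indicator (ball 0 1) y" s]
      by (simp add: s linear_add[OF lin])
  qed
  also have "\<dots> = (\<integral>\<^sup>+x. \<integral>\<^sup>+y. indicator A (T x + y) * indicator (ball 0 1) y \<partial>lborel \<partial>lborel)"
    by (rule lborel_pair.Fubini') measurable
  also have "\<dots> = (\<integral>\<^sup>+x. \<integral>\<^sup>+y. indicator A y * indicator (ball 0 1) (y - T x) \<partial>lborel \<partial>lborel)"
  proof (rule nn_integral_cong)
    fix x :: 'a
    show "(\<integral>\<^sup>+y. indicator A (T x + y) * indicator (ball 0 1) y \<partial>lborel)
        = (\<integral>\<^sup>+y. indicator A y * indicator (ball 0 1) (y - T x) \<partial>lborel)"
      using shift[of "\<lambda>y. indicator A y * indicator (ball 0 1) (y - T x)" "T x"]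
      by (simp add: add.commute)
  qed
  also have "\<dots> = (\<integral>\<^sup>+y. \<integral>\<^sup>+x. indicator A y * indicator (ball 0 1) (y - T x) \<partial>lborel \<partial>lborel)"
    by (rule lborel_pair.Fubini') measurable
  also have "\<dots> = emeasure lborel A * c"
    by (simp add: nn_integral_cmult nn_integral_multc B)
  finally show "emeasure (distr lborel borel T) A = emeasure lborel A"
    using c by (simp add: ennreal_mult_cancel_left mult.commute[of _ c])
qed

section \<open>Normalized area measure: rotations and the law of \<open>|z|^2\<close>\<close>

lemma integral_uniform_measure:
  fixes f :: "'a \<Rightarrow> 'b::{banach, second_countable_topology}"
  assumes A: "A \<in> sets M" "emeasure M A \<noteq> \<infinity>" and f: "f \<in> borel_measurable M"
  shows "(LINT x|uniform_measure M A. f x) = (1 / measure M A) *\<^sub>R (LINT x|M. indicator A x *\<^sub>R f x)"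
proof (cases "measure M A = 0")
  \<comment> \<open>Both sides are 0: on the right because division by zero gives 0, on the left
    because \<open>A\<close> is null, so that every property holds almost everywhere for the uniform
    measure.\<close>
  case True
  then have "emeasure M A = 0"
    using A by (simp add: measure_def enn2real_eq_0_iff)
  then have "AE x in M. x \<notin> A"
    using A by (intro AE_not_in) auto
  then have "AE x in uniform_measure M A. f x = 0"
    using A by (intro AE_uniform_measureI) auto
  then show ?thesis using True by (simp add: integral_eq_zero_AE)
next
  case False
  have "uniform_measure M A = density M (\<lambda>x. ennreal (indicator A x / measure M A))"
    unfolding uniform_measure_def using A False
    by (intro density_cong)
       (auto simp: emeasure_eq_ennreal_measure divide_ennreal indicator_def split: if_splits
        simp flip: ennreal_1 intro!: AE_I2 divide_ennreal zero_less_measure_iff[THEN iffD2])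
  then have "(LINT x|uniform_measure M A. f x) = (LINT x|M. (1 / measure M A) *\<^sub>R (indicator A x *\<^sub>R f x))"
    using A f by (simp add: integral_density)
  then show ?thesis
    by (simp only: integral_scaleR_right)
qed

text \<open>Same as \<open>disc_measure\<close>, but living on all of \<open>UNIV\<close>, with the Borel sets of the plane.\<close>

definition uniform_disc :: "complex measure" where
  "uniform_disc = uniform_measure lborel unit_disc"

lemma emeasure_unit_disc: "emeasure lborel unit_disc = ennreal pi"
  by (simp add: emeasure_ball unit_ball_vol_2)

lemma sets_uniform_disc [simp, measurable_cong]: "sets uniform_disc = sets borel"
  by (simp add: uniform_disc_def)

lemma space_uniform_disc [simp]: "space uniform_disc = UNIV"
  by (simp add: uniform_disc_def)

lemma finite_measure_uniform_disc: "finite_measure uniform_disc"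
  by (intro finite_measureI) (simp add: uniform_disc_def emeasure_unit_disc ennreal_divide_self)

lemma finite_measure_disc_measure: "finite_measure disc_measure"
proof (rule finite_measureI)
  have "space disc_measure = unit_disc"
    by (simp add: disc_measure_def space_restrict_space)
  then show "emeasure disc_measure (space disc_measure) \<noteq> \<infinity>"
    by (simp add: disc_measure_def sets_restrict_space_iff emeasure_restrict_space emeasure_unit_disc ennreal_divide_self)
qed

text \<open>Both measures have Lebesgue density 1/pi on the disc. Extending the integrand by zero
  makes rotations act on the whole underlying space.\<close>

lemma integral_disc_measure:
  fixes f :: "complex \<Rightarrow> 'b::{banach, second_countable_topology}"
  assumes f: "continuous_on unit_disc f"
  shows "(LINT z|disc_measure. f z) = (LINT z|uniform_disc. indicator unit_disc z *\<^sub>R f z)"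
proof -
  have "f \<in> borel_measurable (restrict_space lborel unit_disc)"
    using borel_measurable_continuous_on_restrict[OF f]
    by (simp add: measurable_def space_restrict_space sets_restrict_space)
  then have "(LINT z|disc_measure. f z) = (1 / pi) *\<^sub>R (LINT z|lborel. indicator unit_disc z *\<^sub>R f z)"
    unfolding disc_measure_def
    by (subst integral_uniform_measure)
       (auto simp: sets_restrict_space_iff emeasure_restrict_space measure_restrict_space integral_restrict_space
        emeasure_unit_disc content_ball unit_ball_vol_2 scaleR_scaleR simp flip: indicator_inter_arith
        intro!: Bochner_Integration.integral_cong split: split_indicator)
  also have "\<dots> = (LINT z|uniform_disc. indicator unit_disc z *\<^sub>R f z)"
    unfolding uniform_disc_def
    by (subst integral_uniform_measure)
       (auto simp: emeasure_unit_disc content_ball unit_ball_vol_2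
        intro!: borel_measurable_continuous_on_indicator[OF _ f] Bochner_Integration.integral_cong split: split_indicator)
  finally show ?thesis .
qed

text \<open>Multiplication by a unimodular number is orthogonal and maps the disc onto
  itself.\<close>

lemma uniform_disc_rotate:
  assumes "cmod c = 1"
  shows "distr uniform_disc borel ((*) c) = uniform_disc"
proof (rule measure_eqI)
  fix A assume "A \<in> sets (distr uniform_disc borel ((*) c))"
  then have [measurable]: "A \<in> sets borel" by simp
  have "orthogonal_transformation ((*) c)"
    using assms by (simp add: orthogonal_transformation linear_times norm_mult)
  then have "emeasure lborel (unit_disc \<inter> A) = emeasure (distr lborel borel ((*) c)) (unit_disc \<inter> A)"
    by (simp add: lborel_distr_orthogonal_transformation)
  also have "\<dots> = emeasure lborel (unit_disc \<inter> (*) c -` A)"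
    using assms by (subst emeasure_distr) (auto intro!: arg_cong[of _ _ "emeasure lborel"] simp: norm_mult)
  finally show "emeasure (distr uniform_disc borel ((*) c)) A = emeasure uniform_disc A"
    unfolding uniform_disc_def
    using measurable_sets[of "(*) c" borel borel A] by (subst emeasure_distr) auto
qed simp

text \<open>For \<open>0 \<le> x < 1\<close> the annulus \<open>x < |z|^2 < 1\<close> has area
  \<open>pi * (1 - x)\<close>. Together with rotation invariance this stands in for polar
  coordinates.\<close>

lemma distr_uniform_disc_cmod_power2:
  "distr uniform_disc borel (\<lambda>z. (cmod z)\<^sup>2) = uniform_measure lborel {0..1}"
proof (rule measure_eqI_lessThan)
  fix x :: real
  have L: "emeasure (distr uniform_disc borel (\<lambda>z. (cmod z)\<^sup>2)) {x<..}
      = emeasure lborel (unit_disc \<inter> {z. x < (cmod z)\<^sup>2}) / ennreal pi"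
    unfolding uniform_disc_def
    by (subst emeasure_distr) (auto simp: emeasure_unit_disc vimage_def)
  have R: "emeasure (uniform_measure lborel {0..1}) {x<..} = emeasure lborel ({0..1} \<inter> {x<..})"
    by (simp add: divide_ennreal_def)
  consider "x < 0" | "0 \<le> x" "x < 1" | "1 \<le> x" by linarith
  then show "emeasure (distr uniform_disc borel (\<lambda>z. (cmod z)\<^sup>2)) {x<..} = emeasure (uniform_measure lborel {0..1}) {x<..}"
  proof cases
    case 1
    then have "unit_disc \<inter> {z. x < (cmod z)\<^sup>2} = unit_disc" "{0..1} \<inter> {x<..} = {0..1}"
      by (auto intro: less_le_trans)
    then show ?thesis unfolding L R by (simp add: emeasure_unit_disc ennreal_divide_self)
  next
    case 2
    have eq: "x < (cmod z)\<^sup>2 \<longleftrightarrow> \<not> cmod z \<le> sqrt x" for z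
      using 2 by (metis not_le norm_ge_zero real_sqrt_le_iff real_sqrt_unique)
    have "unit_disc \<inter> {z. x < (cmod z)\<^sup>2} = unit_disc - cball 0 (sqrt x)"
      by (auto simp: eq)
    moreover have "cball 0 (sqrt x) \<subseteq> unit_disc"
      using 2 by (intro cball_subset_ball_iff[THEN iffD2]) (auto simp: real_less_lsqrt)
    moreover have "{0..1} \<inter> {x<..} = {x<..1}" using 2 by auto
    ultimately show ?thesis unfolding L R using 2
      by (simp add: emeasure_Diff emeasure_cball emeasure_unit_disc unit_ball_vol_2 ennreal_minus divide_ennreal field_simps)
  next
    case 3
    have "(cmod z)\<^sup>2 \<le> x" if "cmod z < 1" for z
      using that 3 power_le_one[of "cmod z" 2] by simp
    then have "unit_disc \<inter> {z. x < (cmod z)\<^sup>2} = {}" "{0..1} \<inter> {x<..} = {}"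
      using 3 by (force simp: not_less)+
    then show ?thesis unfolding L R by simp
  qed
  show "emeasure (distr uniform_disc borel (\<lambda>z. (cmod z)\<^sup>2)) {x<..} < \<infinity>"
    using finite_measure.emeasure_finite[OF finite_measure.finite_measure_distr[OF finite_measure_uniform_disc],
        of "\<lambda>z. (cmod z)\<^sup>2" borel "{x<..}"]
    by (simp add: less_top)
qed auto

section \<open>Kernel estimates and the reproducing property\<close>

lemma norm_bergman_denominator_ge:
  assumes "cmod z < 1"
  shows "1 - cmod w \<le> cmod (1 - cnj w * z)"
proof -
  have "cmod (cnj w * z) \<le> cmod w"
    using assms by (simp add: norm_mult mult_left_le)
  then show ?thesis
    using norm_triangle_ineq2[of 1 "cnj w * z"] by simp
qed

lemma bergman_kernel_bound:
  assumes "cmod w < 1" "cmod z < 1"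
  shows "cmod (bergman_kernel w z) \<le> 1 / (1 - cmod w)\<^sup>2"
  using norm_bergman_denominator_ge[OF assms(2), of w] assms(1)
  by (auto simp: bergman_kernel_def norm_divide norm_power intro!: divide_left_mono power_mono mult_pos_pos zero_less_power)

lemma bergman_kernel_holomorphic [holomorphic_intros]:
  assumes "cmod w < 1"
  shows "bergman_kernel w holomorphic_on unit_disc"
proof -
  have "1 - cnj w * z \<noteq> 0" if "cmod z < 1" for z
    using norm_bergman_denominator_ge[OF that, of w] assms by auto
  then show ?thesis
    unfolding bergman_kernel_def[abs_def] by (intro holomorphic_intros) auto
qed

text \<open>On the unit circle conjugation is inversion, which gives the conjugated kernel a double
  pole at \<open>p = w * cnj z\<close>, inside the circle. Cauchy's formula for the derivative at
  \<open>p\<close> evaluates the mean, and \<open>p * z = s\<close>.\<close>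

lemma circle_mean_bergman_kernel:
  assumes f: "f holomorphic_on unit_disc" and w: "cmod w < 1" and z: "cmod z < 1"
  defines "c \<equiv> \<lambda>t::real. exp (2 * of_real pi * \<i> * of_real t)"
  defines "s \<equiv> w * of_real ((cmod z)\<^sup>2)"
  shows "(LINT t|uniform_measure lborel {0..1}. f (c t * z) * cnj (bergman_kernel w (c t * z)))
    = f s + s * deriv f s"
proof -
  let ?F = "\<lambda>t. f (c t * z) * cnj (bergman_kernel w (c t * z))"
  \<comment> \<open>The kernel contributes \<open>\<zeta>^2 / (\<zeta> - p)^2\<close>. One factor
    \<open>\<zeta>\<close> is absorbed by \<open>d\<zeta> = 2 pi \<i> \<zeta> dt\<close>, the other
    goes into \<open>q\<close>.\<close>
  define q where "q \<zeta> = \<zeta> * f (\<zeta> * z)" for \<zeta>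
  define p where "p = w * cnj z"
  have norm_c [simp]: "cmod (c t) = 1" for t
    by (simp add: c_def)
  have p: "cmod p < 1"
    using w z using mult_strict_mono'[of "cmod w" 1 "cmod z" 1] by (simp add: p_def norm_mult)
  have pz: "p * z = s"
    unfolding p_def s_def complex_norm_square by (simp add: mult_ac)
  have in_disc: "cmod (\<zeta> * z) < 1" if "cmod \<zeta> \<le> 1" for \<zeta>
    using mult_right_mono[OF that, of "cmod z"] z by (simp add: norm_mult)
  have in_disc': "cmod (\<zeta> * z) < 1" if "cmod \<zeta> < 1" for \<zeta>
    using in_disc[OF less_imp_le[OF that]] .
  have q_hol: "q holomorphic_on ball 0 1"
    unfolding q_def
    by (intro holomorphic_intros holomorphic_on_compose_gen[OF _ f, unfolded o_def]) (auto intro: in_disc')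
  have q_cont: "continuous_on (cball 0 1) q"
    unfolding q_def
    by (intro continuous_intros continuous_on_compose2[OF holomorphic_on_imp_continuous_on[OF f]])
       (auto intro: in_disc)
  have [continuous_intros]: "continuous_on A c" for A
    unfolding c_def by (intro continuous_intros)
  have F_cont: "continuous_on UNIV ?F"
    by (intro continuous_intros continuous_on_compose2[OF holomorphic_on_imp_continuous_on[OF f]]
        continuous_on_compose2[OF holomorphic_on_imp_continuous_on[OF bergman_kernel_holomorphic[OF w]]])
       (use z in \<open>auto simp: norm_mult\<close>)
  note cauchy = Cauchy_derivative_integral_circlepath[OF q_cont q_hol, of p, simplified, OF p]
  have "(f has_field_derivative deriv f (p * z)) (at (p * z))"
    by (rule holomorphic_derivI[OF f]) (use p in \<open>auto intro: in_disc'\<close>)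
  then have q_deriv: "(q has_field_derivative (f s + s * deriv f s)) (at p)"
    unfolding q_def
    by (auto intro!: derivative_eq_intros DERIV_chain2[where f=f] simp: pz[symmetric])
  have d: "contour_integral (circlepath 0 1) (\<lambda>u. q u / (u - p)\<^sup>2) = 2 * of_real pi * \<i> * (f s + s * deriv f s)"
    using DERIV_unique[OF q_deriv cauchy(2)] by (simp add: field_simps)
  have "((\<lambda>u. q u / (u - p)\<^sup>2) has_contour_integral (2 * of_real pi * \<i> * (f s + s * deriv f s))) (circlepath 0 1)"
    using has_contour_integral_integral[OF cauchy(1)] d by simp
  then have "((\<lambda>t. 2 * of_real pi * \<i> * ?F t) has_integral 2 * of_real pi * \<i> * (f s + s * deriv f s)) {0..1}"
    unfolding has_contour_integral_def
  proof (rule has_integral_eq[rotated])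
    fix t :: real assume t: "t \<in> {0..1}"
    have circ: "circlepath 0 1 t = c t"
      by (simp add: circlepath c_def)
    have vd: "vector_derivative (circlepath 0 1) (at t within {0..1}) = 2 * of_real pi * \<i> * c t"
      using t by (simp add: vector_derivative_circlepath01 c_def)
    have c_inv: "cnj (c t) = 1 / c t"
      using complex_div_cnj[of 1 "c t"] by simp
    have ne: "c t \<noteq> 0" by (simp add: c_def)
    have "cnj (bergman_kernel w (c t * z)) = 1 / (1 - w * (1 / c t * cnj z))\<^sup>2"
      by (simp add: bergman_kernel_def c_inv)
    also have "1 - w * (1 / c t * cnj z) = (c t - p) / c t"
      using ne by (simp add: p_def field_simps)
    finally have "cnj (bergman_kernel w (c t * z)) = (c t)\<^sup>2 / (c t - p)\<^sup>2"
      by (simp add: power_divide)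
    then show "q (circlepath 0 1 t) / (circlepath 0 1 t - p)\<^sup>2 * vector_derivative (circlepath 0 1) (at t within {0..1})
      = 2 * of_real pi * \<i> * ?F t"
      unfolding circ vd by (simp add: q_def power2_eq_square)
  qed
  then have "(?F has_integral (f s + s * deriv f s)) {0..1}"
    by (simp add: has_integral_mult_right_iff)
  moreover have "set_integrable lborel {0..1} ?F"
    unfolding set_integrable_def
    using borel_integrable_compact[of "{0..1}" ?F] F_cont continuous_on_subset by blast
  ultimately have "(LINT t:{0..1}|lborel. ?F t) = f s + s * deriv f s"
    by (simp add: set_borel_integral_eq_integral(2) integral_unique)
  then show ?thesis
    by (subst integral_uniform_measure)
       (use borel_measurable_continuous_onI[OF F_cont] in \<open>auto simp: set_lebesgue_integral_def\<close>)
qed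

text \<open>The bound on \<open>f\<close> makes the integrand bounded, hence integrable over a
  product of two finite measures, as Fubini requires. It is available for the functions of interest:
  a kernel, and a kernel composed with a self-map of the disc.\<close>

lemma bergman_reproducing:
  assumes f: "f holomorphic_on unit_disc" and bound: "\<And>z. cmod z < 1 \<Longrightarrow> cmod (f z) \<le> K" and w: "cmod w < 1"
  shows "bergman_inner f (bergman_kernel w) = f w"
proof -
  define c where "c t = exp (2 * of_real pi * \<i> * of_real t)" for t :: real
  define G where "G z = indicator unit_disc z *\<^sub>R (f z * cnj (bergman_kernel w z))" for z
  define \<Phi> where "\<Phi> t = indicator {0..1} t *\<^sub>R (f (w * of_real t) + w * of_real t * deriv f (w * of_real t))" for t :: real
  let ?V = "uniform_measure lborel {0..1::real}"
  have norm_c [simp]: "cmod (c t) = 1" for t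
    by (simp add: c_def)
  have c_meas [measurable]: "c \<in> borel_measurable borel"
    unfolding c_def[abs_def] by (intro borel_measurable_continuous_onI continuous_intros)
  have prod_cont: "continuous_on unit_disc (\<lambda>z. f z * cnj (bergman_kernel w z))"
    by (intro continuous_intros holomorphic_on_imp_continuous_on f bergman_kernel_holomorphic w)
  have G_meas [measurable]: "G \<in> borel_measurable borel"
    unfolding G_def[abs_def] by (rule borel_measurable_continuous_on_indicator[OF _ prod_cont]) simp
  have G_bound: "cmod (G z) \<le> K * (1 / (1 - cmod w)\<^sup>2)" for z
  proof (cases "cmod z < 1")
    case True
    then show ?thesis
      using mult_mono[OF bound[OF True] bergman_kernel_bound[OF w True] order_trans[OF norm_ge_zero bound[OF True]]]
      by (simp add: G_def norm_mult)
  next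
    case False
    have "0 \<le> K"
      using bound[of 0] norm_ge_zero[of "f 0"] by (simp del: norm_ge_zero)
    then show ?thesis
      using False by (simp add: G_def)
  qed
  have seg: "cmod (w * of_real t) < 1" if "t \<in> {0..1}" for t
    using that w mult_left_le[of t "cmod w"] by (simp add: norm_mult)
  have f'_hol: "deriv f holomorphic_on unit_disc"
    by (rule holomorphic_deriv[OF f]) simp
  have \<Phi>_cont: "continuous_on {0..1} (\<lambda>t. f (w * of_real t) + w * of_real t * deriv f (w * of_real t))"
    using seg
    by (intro continuous_intros continuous_on_compose2[OF holomorphic_on_imp_continuous_on[OF f]]
        continuous_on_compose2[OF holomorphic_on_imp_continuous_on[OF f'_hol]]) auto
  have \<Phi>_meas [measurable]: "\<Phi> \<in> borel_measurable borel"
    unfolding \<Phi>_def[abs_def] by (rule borel_measurable_continuous_on_indicator[OF _ \<Phi>_cont]) simp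
  have rotate: "(LINT z|uniform_disc. G (c t * z)) = (LINT z|uniform_disc. G z)" for t
  proof -
    have "(LINT z|uniform_disc. G z) = (LINT z|distr uniform_disc borel ((*) (c t)). G z)"
      by (simp add: uniform_disc_rotate)
    also have "\<dots> = (LINT z|uniform_disc. G (c t * z))"
      by (rule integral_distr) auto
    finally show ?thesis by simp
  qed
  have V: "emeasure ?V (space ?V) = 1"
    by (simp add: divide_ennreal_def)
  interpret V: finite_measure ?V
    by (rule finite_measureI) (use V in simp)
  interpret U: finite_measure uniform_disc
    by (rule finite_measure_uniform_disc)
  interpret VU: pair_sigma_finite ?V uniform_disc ..
  interpret P: finite_measure "?V \<Otimes>\<^sub>M uniform_disc"
    by (rule finite_measure_pair_measure) unfold_locales
  have integrable: "integrable (?V \<Otimes>\<^sub>M uniform_disc) (\<lambda>(t, z). G (c t * z))"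
    by (rule P.integrable_const_bound[where B="K * (1 / (1 - cmod w)\<^sup>2)"]) (auto simp: G_bound[simplified] case_prod_beta)
  have "bergman_inner f (bergman_kernel w) = (LINT z|uniform_disc. G z)"
    unfolding bergman_inner_def G_def by (rule integral_disc_measure[OF prod_cont])
  \<comment> \<open>No rotation changes the inner integral and \<open>?V\<close> has mass 1, so
    averaging over \<open>t\<close> is free. Exchanging the integrals then exposes the circle mean
    for fixed \<open>z\<close>.\<close>
  also have "\<dots> = (LINT t|?V. LINT z|uniform_disc. G (c t * z))"
    using V by (simp add: rotate measure_def)
  also have "\<dots> = (LINT z|uniform_disc. LINT t|?V. G (c t * z))"
    by (rule VU.Fubini_integral[OF integrable, symmetric])
  also have "\<dots> = (LINT z|uniform_disc. \<Phi> ((cmod z)\<^sup>2))"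
  proof (rule integral_cong_AE)
    show "(\<lambda>z. LINT t|?V. G (c t * z)) \<in> borel_measurable uniform_disc"
      by measurable
    show "(\<lambda>z. \<Phi> ((cmod z)\<^sup>2)) \<in> borel_measurable uniform_disc"
      by measurable
    have "AE z in uniform_disc. cmod z < 1"
      unfolding uniform_disc_def by (rule AE_uniform_measureI) auto
    then show "AE z in uniform_disc. (LINT t|?V. G (c t * z)) = \<Phi> ((cmod z)\<^sup>2)"
    proof eventually_elim
      case (elim z)
      have "(LINT t|?V. G (c t * z)) = (LINT t|?V. f (c t * z) * cnj (bergman_kernel w (c t * z)))"
        using elim by (simp add: G_def norm_mult)
      also have "\<dots> = \<Phi> ((cmod z)\<^sup>2)"
        unfolding c_def circle_mean_bergman_kernel[OF f w elim]
        using elim by (simp add: \<Phi>_def power_le_one)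
      finally show ?case .
    qed
  qed
  also have "\<dots> = (LINT t|distr uniform_disc borel (\<lambda>z. (cmod z)\<^sup>2). \<Phi> t)"
    by (rule integral_distr[symmetric]) auto
  also have "\<dots> = (LINT t|lborel. \<Phi> t)"
    unfolding distr_uniform_disc_cmod_power2
    by (subst integral_uniform_measure) (auto simp: \<Phi>_def intro!: Bochner_Integration.integral_cong split: split_indicator)
  \<comment> \<open>On [0,1] the integrand is the derivative of \<open>t * f (w * t)\<close>, whose
    values at 1 and 0 are \<open>f w\<close> and 0.\<close>
  also have "\<dots> = of_real 1 * f (w * of_real 1) - of_real 0 * f (w * of_real 0)"
    unfolding \<Phi>_def
  proof (rule integral_FTC_atLeastAtMost[OF _ _ \<Phi>_cont])
    fix t :: real assume t: "0 \<le> t" "t \<le> 1"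
    have d: "(f has_field_derivative deriv f (w * of_real t)) (at (w * of_real t))"
      by (rule holomorphic_derivI[OF f]) (use t seg in auto)
    have "((\<lambda>\<zeta>. \<zeta> * f (w * \<zeta>)) has_field_derivative f (w * of_real t) + w * of_real t * deriv f (w * of_real t)) (at (of_real t))"
      using d by (auto intro!: derivative_eq_intros DERIV_chain2[where f=f])
    then show "((\<lambda>t. of_real t * f (w * of_real t)) has_vector_derivative f (w * of_real t) + w * of_real t * deriv f (w * of_real t)) (at t within {0..1})"
      by (intro has_vector_derivative_real_field)
  qed simp
  finally show ?thesis by simp
qed

text \<open>\<open>composition_operator\<close> is specified only on \<open>bergman_space\<close>,
  so the normalized kernels must be placed there before the operator can be unfolded. Boundedness is
  enough because the measure is finite.\<close>

lemma bounded_holomorphic_in_bergman_space: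
  assumes "g holomorphic_on unit_disc" "\<And>z. cmod z < 1 \<Longrightarrow> cmod (g z) \<le> K"
  shows "g \<in> bergman_space"
proof -
  interpret finite_measure disc_measure
    by (rule finite_measure_disc_measure)
  have cont: "continuous_on unit_disc (\<lambda>z. (cmod (g z))\<^sup>2)"
    by (intro continuous_intros holomorphic_on_imp_continuous_on assms(1))
  have "(\<lambda>z. (cmod (g z))\<^sup>2) \<in> borel_measurable disc_measure"
    using borel_measurable_continuous_on_restrict[OF cont]
    by (simp add: measurable_def disc_measure_def space_restrict_space sets_restrict_space)
  moreover have "AE z in disc_measure. norm ((cmod (g z))\<^sup>2) \<le> K\<^sup>2"
    by (rule AE_I2) (auto simp: disc_measure_def space_restrict_space intro!: power_mono assms(2))
  ultimately have "integrable disc_measure (\<lambda>z. (cmod (g z))\<^sup>2)"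
    by (rule integrable_const_bound[rotated])
  then show ?thesis
    using assms(1) by (simp add: bergman_space_def)
qed

text \<open>The reproducing property, applied to the kernel itself, gives its squared norm as
  \<open>bergman_kernel w w\<close>.\<close>

lemma bergman_norm_kernel:
  assumes w: "cmod w < 1"
  shows "bergman_norm (bergman_kernel w) = 1 / (1 - (cmod w)\<^sup>2)"
proof -
  have "complex_of_real (LINT z|disc_measure. (cmod (bergman_kernel w z))\<^sup>2)
      = bergman_inner (bergman_kernel w) (bergman_kernel w)"
    unfolding bergman_inner_def complex_norm_square[symmetric] by (simp del: of_real_power)
  also have "\<dots> = bergman_kernel w w"
    by (rule bergman_reproducing[OF bergman_kernel_holomorphic[OF w] bergman_kernel_bound[OF w] w])
  also have "\<dots> = complex_of_real ((1 / (1 - (cmod w)\<^sup>2))\<^sup>2)"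
  proof -
    have "cnj w * w = complex_of_real ((cmod w)\<^sup>2)"
      unfolding complex_norm_square by (rule mult.commute)
    then show ?thesis
      by (simp add: bergman_kernel_def power_divide)
  qed
  finally have "(LINT z|disc_measure. (cmod (bergman_kernel w z))\<^sup>2) = (1 / (1 - (cmod w)\<^sup>2))\<^sup>2"
    by (simp only: of_real_eq_iff)
  moreover have "(cmod w)\<^sup>2 < 1"
    using w by (simp add: power_less_one_iff abs_square_less_1)
  ultimately show ?thesis
    by (simp add: bergman_norm_def real_sqrt_abs)
qed

section \<open>The Berezin transform of the composition operator\<close>

lemma disc_automorphism_eq_moebius: "disc_automorphism \<alpha> = Moebius_function 0 \<alpha>"
  by (simp add: disc_automorphism_def Moebius_function_def fun_eq_iff)

text \<open>For \<open>\<alpha>\<close> and \<open>w\<close> in the disc this is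
  \<open>((1 - |w|^2) / (1 - cnj w * disc_automorphism \<alpha> w))^2\<close> with the inner
  fraction cleared. The denominator equals \<open>s - 2 \<i> Im u\<close>, which is nonzero because
  \<open>s > 0\<close>.\<close>

definition berezin_symbol :: "complex \<Rightarrow> complex \<Rightarrow> complex" where
  "berezin_symbol \<alpha> w =
    (let s = 1 - (cmod w)\<^sup>2; u = cnj \<alpha> * w
     in (of_real s * (1 - u) / (of_real s - u + cnj u))\<^sup>2)"

text \<open>Once the two normalizing factors are pulled out, the inner product pairs
  \<open>bergman_kernel w \<circ> disc_automorphism \<alpha>\<close> with
  \<open>bergman_kernel w\<close>. The reproducing property evaluates it at
  \<open>w\<close>.\<close>

lemma berezin_range_composition_disc_automorphism:
  assumes \<alpha>: "cmod \<alpha> < 1"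
  shows "berezin_range (composition_operator (disc_automorphism \<alpha>)) = berezin_symbol \<alpha> ` unit_disc"
proof -
  let ?\<phi> = "disc_automorphism \<alpha>"
  have transform: "bergman_inner (composition_operator ?\<phi> (normalized_bergman_kernel w)) (normalized_bergman_kernel w) = berezin_symbol \<alpha> w"
    if w: "cmod w < 1" for w
  proof -
    let ?k = "bergman_kernel w"
    define N where "N = bergman_norm ?k"
    have \<phi>_norm: "cmod (?\<phi> z) < 1" if "cmod z < 1" for z
      using Moebius_function_norm_lt_1[OF \<alpha> that] by (simp add: disc_automorphism_eq_moebius)
    have \<phi>_hol: "?\<phi> holomorphic_on unit_disc"
      using Moebius_function_holomorphic[OF \<alpha>] by (simp add: disc_automorphism_eq_moebius)
    have w2: "(cmod w)\<^sup>2 < 1"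
      using w by (simp add: power_less_one_iff abs_square_less_1)
    have N: "N = 1 / (1 - (cmod w)\<^sup>2)"
      unfolding N_def by (rule bergman_norm_kernel[OF w])
    have "normalized_bergman_kernel w \<in> bergman_space"
    proof (rule bounded_holomorphic_in_bergman_space)
      show "normalized_bergman_kernel w holomorphic_on unit_disc"
        unfolding normalized_bergman_kernel_def[abs_def] N_def[symmetric]
        using w2 by (intro holomorphic_intros w) (auto simp: N)
      show "cmod (normalized_bergman_kernel w z) \<le> 1 / (1 - cmod w)\<^sup>2 / \<bar>N\<bar>" if "cmod z < 1" for z
        unfolding normalized_bergman_kernel_def N_def[symmetric] norm_divide norm_of_real
        by (intro divide_right_mono bergman_kernel_bound w that) auto
    qed
    then have "bergman_inner (composition_operator ?\<phi> (normalized_bergman_kernel w)) (normalized_bergman_kernel w)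
        = (LINT z|disc_measure. (?k (?\<phi> z) * cnj (?k z)) / (complex_of_real N)\<^sup>2)"
      by (simp add: composition_operator_def bergman_inner_def normalized_bergman_kernel_def N_def power2_eq_square)
    also have "\<dots> = bergman_inner (?k \<circ> ?\<phi>) ?k / (complex_of_real N)\<^sup>2"
      by (simp add: bergman_inner_def)
    also have "bergman_inner (?k \<circ> ?\<phi>) ?k = (?k \<circ> ?\<phi>) w"
    proof (rule bergman_reproducing[OF _ _ w])
      show "?k \<circ> ?\<phi> holomorphic_on unit_disc"
        by (rule holomorphic_on_compose_gen[OF \<phi>_hol bergman_kernel_holomorphic[OF w]]) (auto intro: \<phi>_norm)
      show "cmod ((?k \<circ> ?\<phi>) z) \<le> 1 / (1 - cmod w)\<^sup>2" if "cmod z < 1" for z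
        using bergman_kernel_bound[OF w \<phi>_norm[OF that]] by simp
    qed
    also have "(?k \<circ> ?\<phi>) w / (complex_of_real N)\<^sup>2 = berezin_symbol \<alpha> w"
    proof -
      have "cmod (cnj \<alpha> * w) < 1"
        using mult_strict_mono'[of "cmod \<alpha>" 1 "cmod w" 1] \<alpha> w by (simp add: norm_mult)
      then have ne: "1 - cnj \<alpha> * w \<noteq> 0"
        by auto
      have "1 - cnj w * ?\<phi> w = (of_real (1 - (cmod w)\<^sup>2) - cnj \<alpha> * w + cnj (cnj \<alpha> * w)) / (1 - cnj \<alpha> * w)"
        using ne by (simp add: disc_automorphism_def complex_norm_square field_simps del: of_real_power)
      then show ?thesis
        by (simp add: bergman_kernel_def N berezin_symbol_def Let_def power_divide power_mult_distrib)
    qed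
    finally show ?thesis .
  qed
  show ?thesis
    unfolding berezin_range_def Setcompr_eq_image by (rule image_cong) (auto simp: transform)
qed

section \<open>Real points, symmetry and boundary behaviour of the symbol\<close>

text \<open>The symbol is a square \<open>q^2\<close>, so being real forces
  \<open>Re q * Im q = 0\<close>. Here \<open>Re q > 0\<close>, and \<open>Im q\<close> is a
  positive multiple of \<open>y\<close>. Hence \<open>y = 0\<close> and
  \<open>q = 1 - x\<close>.\<close>

lemma berezin_symbol_real_imp_ge:
  assumes \<alpha>: "cmod \<alpha> < 1" and w: "cmod w < 1" and real: "Im (berezin_symbol \<alpha> w) = 0"
  shows "(1 - cmod \<alpha>)\<^sup>2 \<le> Re (berezin_symbol \<alpha> w)"
proof -
  define s where "s = 1 - (cmod w)\<^sup>2"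
  define x y where "x = Re (cnj \<alpha> * w)" and "y = Im (cnj \<alpha> * w)"
  have s: "s > 0"
    using w by (simp add: s_def abs_square_less_1)
  define d where "d = s\<^sup>2 + 4 * y\<^sup>2"
  have d: "d > 0"
    using s by (simp add: d_def add_pos_nonneg)
  \<comment> \<open>This is \<open>s (1 - u) / (s - 2 \<i> y)\<close> after multiplying through by
    the conjugate of the denominator, with \<open>d\<close> the squared modulus of that
    denominator.\<close>
  define q where "q = Complex (s * ((1 - x) * s + 2 * y\<^sup>2) / d) (s * (y * (2 * (1 - x) - s)) / d)"
  have u: "cnj \<alpha> * w = Complex x y"
    by (simp add: x_def y_def complex_eq_iff)
  have sq: "berezin_symbol \<alpha> w = q\<^sup>2"
  proof -
    have "of_real s * (1 - Complex x y) / (of_real s - Complex x y + cnj (Complex x y)) = q"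
      using s d by (simp add: complex_eq_iff q_def d_def Re_divide Im_divide power2_eq_square field_simps)
    then show ?thesis
      by (simp add: berezin_symbol_def Let_def u s_def)
  qed
  \<comment> \<open>Both bounds on \<open>|u|\<close> matter: the one by \<open>|w|\<close> makes
    the factor \<open>2 * (1 - x) - s\<close> of \<open>Im q\<close> at least
    \<open>(1 - |w|)^2\<close>, the one by \<open>|\<alpha>|\<close> gives \<open>Re q > 0\<close>
    and the final estimate.\<close>
  have "cmod (cnj \<alpha> * w) \<le> cmod \<alpha>" "cmod (cnj \<alpha> * w) \<le> cmod w"
    using \<alpha> w by (auto simp: norm_mult mult_left_le mult_left_le_one_le)
  then have x: "x \<le> cmod \<alpha>" "x \<le> cmod w"
    using complex_Re_le_cmod[of "cnj \<alpha> * w"] by (auto simp: x_def)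
  have "0 < (1 - cmod w)\<^sup>2"
    using w by simp
  also have "\<dots> \<le> 2 * (1 - x) - s"
    using x(2) by (simp add: s_def power2_eq_square algebra_simps)
  finally have pos: "0 < 2 * (1 - x) - s" .
  have "(1 - x) * s > 0"
    using x(1) \<alpha> s by simp
  then have "Re q \<noteq> 0"
    using s d by (simp add: q_def add_pos_nonneg less_imp_neq[symmetric])
  moreover have "Re q * Im q = 0"
    using real by (auto simp: sq power2_eq_square)
  ultimately have "Im q = 0"
    by simp
  then have y: "y = 0"
    using s d pos by (simp add: q_def)
  then have "q = of_real (1 - x)"
    using s by (simp add: q_def d_def complex_eq_iff power2_eq_square)
  then have "Re (berezin_symbol \<alpha> w) = (1 - x)\<^sup>2"
    by (simp add: sq flip: of_real_power)
  then show ?thesis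
    using x(1) \<alpha> by (simp add: power_mono)
qed

text \<open>The map \<open>w \<mapsto> \<alpha> * cnj w / cnj \<alpha>\<close> is the reflection in
  the real line spanned by \<open>\<alpha>\<close>. It preserves \<open>|w|\<close> and sends
  \<open>u = cnj \<alpha> * w\<close> to \<open>cnj u\<close>.\<close>

lemma berezin_symbol_conjugate:
  assumes "\<alpha> \<noteq> 0"
  shows "berezin_symbol \<alpha> (\<alpha> * cnj w / cnj \<alpha>) = cnj (berezin_symbol \<alpha> w)"
  using assms by (simp add: berezin_symbol_def Let_def norm_mult norm_divide)

text \<open>The factor \<open>1 - |w|^2\<close> tends to 0 at the circle, so it suffices to approach
  along a radius on which the denominator stays away from 0.\<close>

lemma berezin_symbol_boundary_limit:
  assumes "\<alpha> \<noteq> 0"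
  obtains e where "cmod e = 1" "((\<lambda>r. berezin_symbol \<alpha> (of_real r * e)) \<longlongrightarrow> 0) (at_left 1)"
proof
  \<comment> \<open>Perpendicular to \<open>\<alpha>\<close>, \<open>u = \<i> |\<alpha>| r\<close>
    is imaginary and the denominator tends to \<open>-2 \<i> |\<alpha>|\<close>. Along
    \<open>\<alpha>\<close> itself \<open>u\<close> would be real and the value
    \<open>(1 - u)^2\<close>, which does not tend to 0.\<close>
  define e where "e = \<i> * \<alpha> / of_real (cmod \<alpha>)"
  show norm_e: "cmod e = 1"
    using assms by (simp add: e_def norm_mult norm_divide)
  have "cnj \<alpha> * \<alpha> = of_real (cmod \<alpha>) * of_real (cmod \<alpha>)"
    using complex_norm_square[of \<alpha>] by (simp add: power2_eq_square mult.commute)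
  then have e: "cnj \<alpha> * e = \<i> * of_real (cmod \<alpha>)"
    using assms by (simp add: e_def mult.left_commute)
  define g where "g r = (of_real (1 - r\<^sup>2) * (1 - \<i> * of_real (cmod \<alpha> * r))
    / (of_real (1 - r\<^sup>2) - 2 * \<i> * of_real (cmod \<alpha> * r)))\<^sup>2" for r :: real
  have g: "berezin_symbol \<alpha> (of_real r * e) = g r" for r
  proof -
    have "cnj \<alpha> * (of_real r * e) = \<i> * of_real (cmod \<alpha> * r)"
      using e by (simp add: mult.left_commute mult.commute)
    then show ?thesis
      by (simp only: berezin_symbol_def Let_def) (simp add: g_def norm_mult norm_e mult_ac)
  qed
  have "isCont g 1"
    unfolding g_def using assms by (intro continuous_intros) auto
  moreover have "g 1 = 0"
    by (simp add: g_def)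
  ultimately show "((\<lambda>r. berezin_symbol \<alpha> (of_real r * e)) \<longlongrightarrow> 0) (at_left 1)"
    by (simp add: g isCont_def filterlim_at_split)
qed

section \<open>Convexity of the range\<close>

theorem theorem5p7:
  fixes \<alpha> :: complex
  assumes "\<alpha> \<in> unit_disc"
  shows "convex (berezin_range (composition_operator (disc_automorphism \<alpha>))) \<longleftrightarrow> \<alpha> = 0"
proof -
  have \<alpha>: "cmod \<alpha> < 1"
    using assms by simp
  note range = berezin_range_composition_disc_automorphism[OF \<alpha>]
  show ?thesis
  proof
    assume "\<alpha> = 0"
    \<comment> \<open>Here \<open>u = 0\<close> and the symbol is \<open>(s / s)^2\<close>, so only
      \<open>s \<noteq> 0\<close> has to be checked.\<close>
    have "berezin_symbol 0 w = 1" if "cmod w < 1" for w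
    proof -
      have "(cmod w)\<^sup>2 < 1"
        using that by (simp add: abs_square_less_1)
      then have "(cmod w)\<^sup>2 \<noteq> 1" "complex_of_real ((cmod w)\<^sup>2) \<noteq> 1"
        unfolding of_real_eq_1_iff by auto
      then show ?thesis
        by (simp add: berezin_symbol_def)
    qed
    then have "berezin_symbol 0 ` unit_disc \<subseteq> {1}"
      by auto
    then have "berezin_symbol 0 ` unit_disc = {} \<or> berezin_symbol 0 ` unit_disc = {1}"
      by (simp add: subset_singleton_iff)
    then show "convex (berezin_range (composition_operator (disc_automorphism \<alpha>)))"
      unfolding range unfolding \<open>\<alpha> = 0\<close> by (metis convex_empty convex_singleton)
  next
    assume conv: "convex (berezin_range (composition_operator (disc_automorphism \<alpha>)))"
    show "\<alpha> = 0"
    proof (rule ccontr)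
      assume ne: "\<alpha> \<noteq> 0"
      \<comment> \<open>The midpoint of \<open>?b\<close> and its conjugate is \<open>Re ?b\<close>.
        Convexity makes it the value of the symbol at some \<open>v\<close>, in general not
        \<open>w\<close>, and the bound for real values applies at \<open>v\<close>.\<close>
      have Re_ge: "(1 - cmod \<alpha>)\<^sup>2 \<le> Re (berezin_symbol \<alpha> w)" if w: "cmod w < 1" for w
      proof -
        let ?b = "berezin_symbol \<alpha> w"
        have "cnj ?b = berezin_symbol \<alpha> (\<alpha> * cnj w / cnj \<alpha>)"
          by (rule berezin_symbol_conjugate[OF ne, symmetric])
        moreover have "cmod (\<alpha> * cnj w / cnj \<alpha>) < 1"
          using ne w by (simp add: norm_mult norm_divide)
        ultimately have "cnj ?b \<in> berezin_symbol \<alpha> ` unit_disc" "?b \<in> berezin_symbol \<alpha> ` unit_disc"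
          using w by auto
        from convexD[OF conv[unfolded range] this, of "1/2" "1/2"]
        have "(1/2) *\<^sub>R cnj ?b + (1/2) *\<^sub>R ?b \<in> berezin_symbol \<alpha> ` unit_disc"
          by simp
        also have "(1/2) *\<^sub>R cnj ?b + (1/2) *\<^sub>R ?b = of_real (Re ?b)"
          by (simp add: complex_eq_iff)
        finally obtain v where "cmod v < 1" "of_real (Re ?b) = berezin_symbol \<alpha> v"
          by auto
        with berezin_symbol_real_imp_ge[OF \<alpha>, of v] show ?thesis
          by (metis Im_complex_of_real Re_complex_of_real)
      qed
      \<comment> \<open>Along this radius the real parts tend to 0, so the uniform lower bound
        passes to the limit and contradicts \<open>|\<alpha>| < 1\<close>.\<close>
      obtain e where e: "cmod e = 1" "((\<lambda>r. berezin_symbol \<alpha> (of_real r * e)) \<longlongrightarrow> 0) (at_left 1)"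
        using berezin_symbol_boundary_limit[OF ne] by blast
      have "\<forall>\<^sub>F r in at_left (1::real). r \<in> {0<..<1}"
        by (rule eventually_at_left_real) simp
      then have "\<forall>\<^sub>F r in at_left 1. (1 - cmod \<alpha>)\<^sup>2 \<le> Re (berezin_symbol \<alpha> (of_real r * e))"
        by eventually_elim (auto intro!: Re_ge simp: norm_mult e(1))
      from tendsto_lowerbound[OF tendsto_Re[OF e(2)] this trivial_limit_at_left_real]
      have "(1 - cmod \<alpha>)\<^sup>2 \<le> 0"
        by simp
      then show False
        using \<alpha> by simp
    qed
  qed
qed

end
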